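(* Let $0<\lambda<1$, let $d\ge0$ be a real number, and let $p(i)\in[0,1]$, $i\in\mathbb{N}$, satisfy $$\sum_{i=0}^\infty p(i)=1\qquad\text{and}\qquad\sum_{i=0}^\infty i\,p(i)\le d.$$ Let $\varphi(x):=\sum_{i=0}^\infty x^ip(i)$ for $x\in[0,1]$, and define $q^*(0):=1$, $q^*(1):=\lambda$ and $q^*(i):=\lambda q^*(i-1)\varphi(q^*(i-1))$ for $i>1$. Then, for all $i\ge1$, $$q^*(i)\ge\begin{cases}\lambda^i&\text{if } d=0,\\ \lambda^{\frac{(d+1)^i-1}{d}}&\text{if } d>0.\end{cases}$$ If $d\in\mathbb{N}$ and $p(d)=1$, then equality holds for all $i\ge1$; if it is not the case that $d\in\mathbb{N}$ and $p(d)=1$, then the inequality is strict for all $i\ge2$.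
   Context: $\mathbb{N}$ includes $0$, and $0^0=1$ in the definition of $\varphi$. *)

theory Defs
  imports Complex_Main
begin

definition phi :: "(nat \<Rightarrow> real) \<Rightarrow> real \<Rightarrow> real" where
  "phi p x = (\<Sum>i. x ^ i * p i)"

fun qstar :: "real \<Rightarrow> (nat \<Rightarrow> real) \<Rightarrow> nat \<Rightarrow> real" where
  "qstar lam p 0 = 1"
| "qstar lam p (Suc 0) = lam"
| "qstar lam p (Suc (Suc i)) = lam * qstar lam p (Suc i) * phi p (qstar lam p (Suc i))"

definition qbound :: "real \<Rightarrow> real \<Rightarrow> nat \<Rightarrow> real" where
  "qbound lam d i = (if d = 0 then lam ^ i else lam powr (((d + 1) ^ i - 1) / d))"

end

theory Submission
  imports Defs
begin

text \<open>
  The generating function of a probability distribution with mean at most \<open>d\<close> satisfies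
  \<open>\<phi>(x) \<ge> x\<^sup>d\<close> on \<open>(0,1)\<close>. This is Jensen's inequality for the convex function
  \<open>t \<mapsto> x\<^sup>t\<close>, followed by the fact that this function is decreasing. It is proved here by
  summing the tangent line bound \<open>x\<^sup>t \<ge> x\<^sup>d (1 + (t - d) ln x)\<close> against \<open>p\<close>
  (lemma \<open>powr_le_phi\<close>). The tangent line touches only at \<open>t = d\<close>, so the inequality is strict
  unless all the mass of \<open>p\<close> sits at \<open>d\<close> (lemma \<open>powr_less_phi\<close>).

  The claimed bound \<open>b\<^sub>i\<close> is exactly the solution of the recursion of \<open>q\<^sup>*\<close> with \<open>\<phi>(x)\<close>
  replaced by \<open>x\<^sup>d\<close>, namely \<open>b\<^sub>i\<^sub>+\<^sub>1 = \<lambda> b\<^sub>i\<^sup>d\<^sup>+\<^sup>1\<close> (lemma \<open>qbound_Suc\<close>). Since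
  \<open>x \<mapsto> \<lambda> x\<^sup>d\<^sup>+\<^sup>1\<close> is increasing, induction transports the inequality along the
  recursion. A strict inequality for \<open>\<phi>\<close> enters at the step to \<open>i = 2\<close>, the first one that uses
  \<open>\<phi>\<close>, and again at each later step, because \<open>q\<^sup>*(i)\<close> lies in \<open>(0,1)\<close> for \<open>i \<ge> 1\<close>.
\<close>

text \<open>
  The tangent line of \<open>t \<mapsto> x\<^sup>t\<close> at \<open>t = d\<close>: after division by \<open>x\<^sup>d\<close> it is the bound
  \<open>1 + y \<le> exp y\<close> with \<open>y = (t - d) ln x\<close>, in which equality forces \<open>y = 0\<close>.
\<close>

lemma powr_tangent_le:
  fixes x d t :: real
  assumes "0 < x"
  shows "x powr d * (1 + (t - d) * ln x) \<le> x powr t"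
proof -
  have "x powr t = x powr d * exp ((t - d) * ln x)"
    using assms by (simp add: powr_def algebra_simps flip: exp_add)
  then show ?thesis
    using exp_ge_add_one_self[of "(t - d) * ln x"] by (simp add: mult_left_mono)
qed

lemma powr_tangent_less:
  fixes x d t :: real
  assumes "0 < x" "x \<noteq> 1" "t \<noteq> d"
  shows "x powr d * (1 + (t - d) * ln x) < x powr t"
proof -
  have "x powr t = x powr d * exp ((t - d) * ln x)"
    using assms by (simp add: powr_def algebra_simps flip: exp_add)
  moreover have "1 + (t - d) * ln x < exp ((t - d) * ln x)"
  proof -
    have "(t - d) * ln x \<noteq> 0" using assms by simp
    then show ?thesis
      using exp_ge_add_one_self[of "(t - d) * ln x"] ln_eq_minus_one[of "exp ((t - d) * ln x)"]
      by (force simp: order.strict_iff_order)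
  qed
  ultimately show ?thesis
    using assms by simp
qed

lemma summable_phi:
  fixes p :: "nat \<Rightarrow> real" and x :: real
  assumes "\<And>i. 0 \<le> p i" "summable p" "0 \<le> x" "x \<le> 1"
  shows "summable (\<lambda>i. x ^ i * p i)"
proof (rule summable_comparison_test[OF _ assms(2)])
  show "\<exists>N. \<forall>n\<ge>N. norm (x ^ n * p n) \<le> p n"
    using assms by (auto simp: abs_mult power_le_one intro!: mult_left_le_one_le)
qed

lemma phi_le_one:
  fixes p :: "nat \<Rightarrow> real" and x :: real
  assumes "\<And>i. 0 \<le> p i" "p sums 1" "0 \<le> x" "x \<le> 1"
  shows "phi p x \<le> 1"
proof -
  have "phi p x \<le> (\<Sum>i. p i)"
    unfolding phi_def using assms
    by (intro suminf_le summable_phi)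
       (auto simp: power_le_one sums_iff intro!: mult_left_le_one_le)
  then show ?thesis using assms(2) by (simp add: sums_iff)
qed

text \<open>
  The total gap in the tangent line bound. For \<open>x > 0\<close> its terms are nonnegative, so the sum
  bounds \<open>\<phi>(x)\<close> from below by the value of the tangent at the mean \<open>m\<close>; when \<open>m \<le> d\<close>
  that value is at least \<open>x\<^sup>d\<close>, as the tangent has the nonpositive slope \<open>x\<^sup>d ln x\<close>.
\<close>

lemma sums_tangent_gap:
  fixes p :: "nat \<Rightarrow> real" and x d m :: real
  assumes "\<And>i. 0 \<le> p i" "p sums 1" "(\<lambda>i. real i * p i) sums m" "0 \<le> x" "x \<le> 1"
  shows "(\<lambda>i. (x ^ i - x powr d * (1 + (real i - d) * ln x)) * p i)
           sums (phi p x - x powr d * (1 + (m - d) * ln x))"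
proof -
  have "(\<lambda>i. x ^ i * p i) sums phi p x"
    unfolding phi_def using summable_phi[of p x] assms by (simp add: summable_sums sums_iff)
  moreover have "(\<lambda>i. x powr d * (p i + (real i * p i - d * p i) * ln x))
      sums (x powr d * (1 + (m - d * 1) * ln x))"
    using assms by (intro sums_mult sums_add sums_mult2 sums_diff)
  ultimately have "(\<lambda>i. x ^ i * p i - x powr d * (p i + (real i * p i - d * p i) * ln x))
      sums (phi p x - x powr d * (1 + (m - d * 1) * ln x))"
    by (rule sums_diff)
  then show ?thesis by (simp add: algebra_simps)
qed

lemma powr_le_powr_tangent:
  fixes x d m :: real
  assumes "0 < x" "x \<le> 1" "m \<le> d"
  shows "x powr d \<le> x powr d * (1 + (m - d) * ln x)"
proof -
  have "0 \<le> (m - d) * ln x" using assms by (intro mult_nonpos_nonpos) auto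
  then show ?thesis using assms by simp
qed

lemma powr_le_phi:
  fixes p :: "nat \<Rightarrow> real" and x d m :: real
  assumes "\<And>i. 0 \<le> p i" "p sums 1" "(\<lambda>i. real i * p i) sums m" "m \<le> d" "0 < x" "x \<le> 1"
  shows "x powr d \<le> phi p x"
proof -
  have "0 \<le> phi p x - x powr d * (1 + (m - d) * ln x)"
  proof (rule sums_le[OF _ sums_zero sums_tangent_gap])
    show "0 \<le> (x ^ i - x powr d * (1 + (real i - d) * ln x)) * p i" for i
      using powr_tangent_le[of x d "real i"] assms by (simp add: powr_realpow)
  qed (use assms in auto)
  moreover have "x powr d \<le> x powr d * (1 + (m - d) * ln x)"
    using powr_le_powr_tangent assms by simp
  ultimately show ?thesis by linarith
qed

lemma powr_less_phi:
  fixes p :: "nat \<Rightarrow> real" and x d m :: real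
  assumes "\<And>i. 0 \<le> p i" "p sums 1" "(\<lambda>i. real i * p i) sums m" "m \<le> d" "0 < x" "x < 1"
    and mass: "real j \<noteq> d" "p j \<noteq> 0"
  shows "x powr d < phi p x"
proof -
  let ?g = "\<lambda>i. (x ^ i - x powr d * (1 + (real i - d) * ln x)) * p i"
  have gap: "?g sums (phi p x - x powr d * (1 + (m - d) * ln x))"
    using assms by (intro sums_tangent_gap) auto
  have "0 < (\<Sum>i. ?g i)"
  proof (rule suminf_pos2[where i = j])
    show "summable ?g" using gap by (rule sums_summable)
    show "0 \<le> ?g i" for i
      using powr_tangent_le[of x d "real i"] assms by (simp add: powr_realpow)
    have "0 < p j" using assms(1)[of j] mass by simp
    then show "0 < ?g j"
      using powr_tangent_less[of x "real j" d] assms by (simp add: powr_realpow)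
  qed
  then have "x powr d * (1 + (m - d) * ln x) < phi p x"
    using gap by (simp add: sums_iff)
  moreover have "x powr d \<le> x powr d * (1 + (m - d) * ln x)"
    using powr_le_powr_tangent assms by simp
  ultimately show ?thesis by linarith
qed

lemma sums_one_point_mass:
  fixes p :: "nat \<Rightarrow> real"
  assumes "\<And>i. 0 \<le> p i" "p sums 1" "p n = 1" "i \<noteq> n"
  shows "p i = 0"
proof -
  have "sum p {n, i} \<le> (\<Sum>i. p i)"
    using assms by (intro sum_le_suminf) (auto simp: sums_iff)
  then show ?thesis
    using assms(1)[of i] assms(2-4) by (simp add: sums_iff)
qed

lemma phi_point_mass:
  fixes p :: "nat \<Rightarrow> real"
  assumes "\<And>i. 0 \<le> p i" "p sums 1" "p n = 1"
  shows "phi p x = x ^ n"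
proof -
  have "phi p x = (\<Sum>i\<in>{n}. x ^ i * p i)"
    unfolding phi_def using sums_one_point_mass[OF assms]
    by (intro suminf_finite) auto
  then show ?thesis using assms by simp
qed

lemma ex_mass_away:
  fixes p :: "nat \<Rightarrow> real" and d :: real
  assumes "p sums 1" "\<not> (\<exists>n::nat. d = real n \<and> p n = 1)"
  shows "\<exists>j. real j \<noteq> d \<and> p j \<noteq> 0"
proof (rule ccontr)
  assume "\<not> ?thesis"
  then have zero: "p j = 0" if "real j \<noteq> d" for j using that by blast
  show False
  proof (cases "\<exists>n::nat. d = real n")
    case True
    then obtain n where n: "d = real n" by blast
    then have "p sums (\<Sum>i\<in>{n}. p i)" using zero by (intro sums_finite) auto
    then have "p n = 1" using assms(1) by (simp add: sums_iff)
    then show False using assms(2) n by blast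
  next
    case False
    then have "p = (\<lambda>_. 0)" using zero by (intro ext) metis
    then show False using assms(1) by (simp add: sums_iff)
  qed
qed

lemma qbound_1:
  assumes "0 < lam"
  shows "qbound lam d 1 = lam"
  using assms by (simp add: qbound_def)

lemma qbound_pos:
  assumes "0 < lam"
  shows "0 < qbound lam d i"
  using assms by (simp add: qbound_def)

text \<open>
  The exponents \<open>e\<^sub>i = ((d + 1)\<^sup>i - 1) / d\<close> are the partial sums of the geometric series with
  ratio \<open>d + 1\<close>, so \<open>e\<^sub>i\<^sub>+\<^sub>1 = 1 + (d + 1) e\<^sub>i\<close>. At \<open>d = 0\<close> the exponent is \<open>i\<close>,
  which obeys the same recursion.
\<close>

lemma qbound_Suc:
  assumes "0 < lam"
  shows "qbound lam d (Suc i) = lam * qbound lam d i powr (d + 1)"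
proof (cases "d = 0")
  case True
  then show ?thesis using assms by (simp add: qbound_def)
next
  case False
  have "((d + 1) ^ Suc i - 1) / d = 1 + ((d + 1) ^ i - 1) / d * (d + 1)"
    using False by (simp add: field_simps)
  then show ?thesis
    using False assms powr_add[of lam 1 "((d + 1) ^ i - 1) / d * (d + 1)"]
    by (simp only: qbound_def powr_powr if_False powr_one less_imp_le)
qed

lemma qstar_Suc:
  assumes "1 \<le> i"
  shows "qstar lam p (Suc i) = lam * qstar lam p i * phi p (qstar lam p i)"
  using assms by (cases i) auto

text \<open>
  Positivity propagates because \<open>\<phi>(x) \<ge> x\<^sup>m > 0\<close>, which is the Jensen bound with the exact mean
  \<open>m\<close> as exponent; the upper bound comes from \<open>\<phi>(x) \<le> 1\<close>.
\<close>

lemma qstar_bounds: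
  fixes p :: "nat \<Rightarrow> real" and lam d m :: real
  assumes lam: "0 < lam" "lam < 1" and "1 \<le> i"
    and p: "\<And>i. 0 \<le> p i" "p sums 1" "(\<lambda>i. real i * p i) sums m"
  shows "0 < qstar lam p i \<and> qstar lam p i < 1"
  using \<open>1 \<le> i\<close>
proof (induction i rule: dec_induct)
  case base
  then show ?case using lam by simp
next
  case (step i)
  let ?q = "qstar lam p i"
  have "0 < ?q powr m" using step.IH by simp
  also have "\<dots> \<le> phi p ?q"
    using powr_le_phi[OF p order_refl] step.IH by simp
  finally have pos: "0 < phi p ?q" .
  have "?q * phi p ?q \<le> 1"
    using phi_le_one[of p ?q] p step.IH pos by (intro mult_le_one) auto
  then have "lam * (?q * phi p ?q) \<le> lam"
    using lam by simp
  then have "lam * (?q * phi p ?q) < 1"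
    using lam by linarith
  then show ?case
    using qstar_Suc[OF step.hyps(1)] lam pos step.IH by (simp add: mult.assoc)
qed

text \<open>
  Here the monotonicity of \<open>x \<mapsto> \<lambda> x\<^sup>d\<^sup>+\<^sup>1\<close> turns a bound at \<open>i\<close> into the comparison
  of \<open>b\<^sub>i\<^sub>+\<^sub>1\<close> with one step of the recursion in which \<open>\<phi>\<close> is replaced by the power.
\<close>

lemma qbound_Suc_le:
  fixes q lam d :: real
  assumes "0 < lam" "0 \<le> d" "qbound lam d i \<le> q"
  shows "qbound lam d (Suc i) \<le> lam * q * q powr d"
proof -
  have q: "0 < q" using qbound_pos[OF assms(1), of d i] assms(3) by linarith
  have "qbound lam d (Suc i) \<le> lam * q powr (d + 1)"
    using assms qbound_pos[OF assms(1), of d i]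
    by (simp add: qbound_Suc powr_mono2 less_imp_le)
  also have "\<dots> = lam * q * q powr d"
    using q by (simp add: powr_add)
  finally show ?thesis .
qed

theorem proposition7:
  fixes lam d :: real and p :: "nat \<Rightarrow> real"
  assumes "0 < lam" and "lam < 1"
    and "d \<ge> 0"
    and "\<And>i. p i \<in> {0..1}"
    and "p sums 1"
    and "summable (\<lambda>i. real i * p i)"
    and "(\<Sum>i. real i * p i) \<le> d"
  shows "(\<forall>i\<ge>1. qstar lam p i \<ge> qbound lam d i) \<and>
    ((\<exists>n::nat. d = real n \<and> p n = 1) \<longrightarrow> (\<forall>i\<ge>1. qstar lam p i = qbound lam d i)) \<and>
    (\<not> (\<exists>n::nat. d = real n \<and> p n = 1) \<longrightarrow> (\<forall>i\<ge>2. qstar lam p i > qbound lam d i))"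
proof -
  have p0: "0 \<le> p i" for i using assms(4)[of i] by simp
  define m where "m = (\<Sum>i. real i * p i)"
  have m: "(\<lambda>i. real i * p i) sums m" "m \<le> d"
    using assms(6,7) by (auto simp: m_def summable_sums)
  have q01: "0 < qstar lam p i" "qstar lam p i < 1" if "1 \<le> i" for i
    using qstar_bounds[OF assms(1,2) that p0 assms(5) m(1)] by auto
  have ge: "qbound lam d i \<le> qstar lam p i" if "1 \<le> i" for i
    using that
  proof (induction i rule: dec_induct)
    case base
    then show ?case using assms(1) by (simp add: qbound_1[unfolded One_nat_def])
  next
    case (step i)
    let ?q = "qstar lam p i"
    have "qbound lam d (Suc i) \<le> lam * ?q * ?q powr d"
      using qbound_Suc_le[OF assms(1,3) step.IH] .
    also have "\<dots> \<le> lam * ?q * phi p ?q"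
      using powr_le_phi[OF p0 assms(5) m] q01[OF step.hyps(1)] assms(1)
      by (intro mult_left_mono) auto
    finally show ?case using qstar_Suc[OF step.hyps(1)] by simp
  qed
  moreover have "qstar lam p i = qbound lam d i"
    if n: "d = real n" "p n = 1" and "1 \<le> i" for n i
    using \<open>1 \<le> i\<close>
  proof (induction i rule: dec_induct)
    case base
    then show ?case using assms(1) by (simp add: qbound_1[unfolded One_nat_def])
  next
    case (step i)
    let ?b = "qbound lam d i"
    have "qstar lam p (Suc i) = lam * ?b * ?b ^ n"
      using qstar_Suc[OF step.hyps(1)] step.IH phi_point_mass[OF p0 assms(5) n(2)] by simp
    also have "\<dots> = qbound lam d (Suc i)"
      using qbound_pos[OF assms(1), of d i] assms(1) n(1)
      by (simp add: qbound_Suc powr_add powr_realpow)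
    finally show ?case .
  qed
  moreover have "qbound lam d i < qstar lam p i"
    if nomass: "\<not> (\<exists>n::nat. d = real n \<and> p n = 1)" and "2 \<le> i" for i
  proof -
    obtain j where j: "real j \<noteq> d" "p j \<noteq> 0"
      using ex_mass_away[OF assms(5) nomass] by blast
    obtain k where k: "i = Suc k" "1 \<le> k"
      using \<open>2 \<le> i\<close> by (cases i) auto
    let ?q = "qstar lam p k"
    have "qbound lam d (Suc k) \<le> lam * ?q * ?q powr d"
      using qbound_Suc_le[OF assms(1,3) ge[OF k(2)]] .
    also have "\<dots> < lam * ?q * phi p ?q"
      using powr_less_phi[OF p0 assms(5) m _ _ j] q01[OF k(2)] assms(1) by simp
    finally show ?thesis using qstar_Suc[OF k(2)] k(1) by simp
  qed
  ultimately show ?thesis by blast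
qed

end
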